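(* There exist absolute constants $c,d>0$ such that for every $k\in\mathbb{N}$ and every $k$-player game $\mathcal{G}$: if $\mathcal{V}_{\mathrm{subNS}}(\mathcal{G})\geq 1-2^{-ck^2}$ then $\mathcal{V}_{\mathrm{NS}}(\mathcal{G})\geq 2^{-dk^2}$. Moreover, for every $\delta\leq \frac{1}{k^{3k}}$, if $\mathcal{V}_{\mathrm{subNS}_\delta}(\mathcal{G})\geq 1-\delta^2$ then $\mathcal{V}_{\mathrm{NS}}(\mathcal{G})\geq\frac{1}{k^{3k}}$.
   Context: A $k$-player game is $\mathcal{G}=(\mathcal{Q},\mathcal{A},V,\pi)$ where $\mathcal{Q}=Q_1\times\cdots\times Q_k$ and $\mathcal{A}=A_1\times\cdots\times A_k$ are finite sets, $V:\mathcal{Q}\times\mathcal{A}\to\{0,1\}$, and $\pi$ is a probability distribution on $\mathcal{Q}$. For $S\subseteq[k]$ write $\mathcal{Q}_S=\prod_{i\in S}Q_i$, $\mathcal{A}_S=\prod_{i\in S}A_i$, $q_S=(q_i)_{i\in S}$, $a_S=(a_i)_{i\in S}$. A strategy is a family $\{p_q\}_{q\in\mathcal{Q}}$ of probability distributions on $\mathcal{A}\cup\{\bot\}$; write $p_q(a_S)=\sum_{a^*\in\mathcal{A}:a^*_S=a_S}p_q(a^* )$. It is non-signaling if there exist probability distributions $\mathrm{Sim}_{S,q_S}$ on $\mathcal{A}_S$ (for all $S\subseteq[k]$, $q_S\in\mathcal{Q}_S$) with $p_q(a_S)=\mathrm{Sim}_{S,q_S}(a_S)$ for all $q\in\mathcal{Q}$,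 $S\subseteq[k]$, $a_S\in\mathcal{A}_S$; it is sub-non-signaling if instead $p_q(a_S)\leq\mathrm{Sim}_{S,q_S}(a_S)$ for all such $q,S,a_S$. $\mathrm{subNS}_\delta(\mathcal{G})$ is the set of sub-non-signaling strategies with $p_q(\bot)\leq\delta$ for every $q\in\mathcal{Q}$. For a class of strategies, the value of $\mathcal{G}$ is the maximum over that class of $\sum_{q}\pi(q)\sum_{a\in\mathcal{A}}p_q(a)V(q,a)$; $\mathcal{V}_{\mathrm{NS}},\mathcal{V}_{\mathrm{subNS}},\mathcal{V}_{\mathrm{subNS}_\delta}$ denote the values over non-signaling, sub-non-signaling, and $\mathrm{subNS}_\delta(\mathcal{G})$ strategies respectively.
   Formalization: The "moreover" part is stated for k ≥ 2 and δ ≥ 0 (it is false for k = 1, e.g. two questions of probability 3/4, 1/4, won resp. lost, δ = 1/2); k ≥ 1 throughout, answer sets are nonempty, and questions and answers are natural numbers, which covers all finite games up to renaming. *)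

theory Defs
  imports "HOL-Probability.Probability_Mass_Function"
begin

text \<open>
  Players are \<open>1, \<dots>, k\<close>.  Tuples indexed by a set \<open>S\<close> of players are elements of the extensional
  product \<^term>\<open>PiE S X\<close>, and \<open>q\<^sub>S\<close> is \<^term>\<open>restrict q S\<close>.

  A constant that is to be the same for all games cannot be quantified outside a type variable.
  Statements with absolute constants are therefore made for \<open>(nat, nat) game\<close>; as all question and
  answer sets are finite subsets of the carrier type, every game is of this form up to renaming
  questions and answers.
\<close>

record ('q, 'a) game =
  num_players :: nat
  questions :: "nat \<Rightarrow> 'q set"
  answers :: "nat \<Rightarrow> 'a set"
  verdict :: "(nat \<Rightarrow> 'q) \<Rightarrow> (nat \<Rightarrow> 'a) \<Rightarrow> bool"
  query_dist :: "(nat \<Rightarrow> 'q) pmf"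

definition players :: "('q, 'a) game \<Rightarrow> nat set" where
  "players G = {1..num_players G}"

definition questions_on :: "('q, 'a) game \<Rightarrow> nat set \<Rightarrow> (nat \<Rightarrow> 'q) set" where
  "questions_on G S = PiE S (questions G)"

definition answers_on :: "('q, 'a) game \<Rightarrow> nat set \<Rightarrow> (nat \<Rightarrow> 'a) set" where
  "answers_on G S = PiE S (answers G)"

abbreviation all_questions :: "('q, 'a) game \<Rightarrow> (nat \<Rightarrow> 'q) set" where
  "all_questions G \<equiv> questions_on G (players G)"

abbreviation all_answers :: "('q, 'a) game \<Rightarrow> (nat \<Rightarrow> 'a) set" where
  "all_answers G \<equiv> answers_on G (players G)"

text \<open>
  Answer sets have to be nonempty, since otherwise there is no distribution on \<open>A\<^sub>S\<close> and hence no
  (sub-)non-signaling strategy.  Nonemptiness of the question sets is forced by the query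
  distribution.
\<close>

definition is_game :: "('q, 'a) game \<Rightarrow> bool" where
  "is_game G \<longleftrightarrow>
     (\<forall>i\<in>players G. finite (questions G i) \<and> finite (answers G i) \<and> answers G i \<noteq> {}) \<and>
     set_pmf (query_dist G) \<subseteq> all_questions G"

text \<open>The outcome \<^term>\<open>None\<close> plays the role of the abort symbol \<open>\<bottom>\<close>.\<close>

type_synonym ('q, 'a) strategy = "(nat \<Rightarrow> 'q) \<Rightarrow> (nat \<Rightarrow> 'a) option pmf"

definition is_strategy :: "('q, 'a) game \<Rightarrow> ('q, 'a) strategy \<Rightarrow> bool" where
  "is_strategy G p \<longleftrightarrow>
     (\<forall>q\<in>all_questions G. set_pmf (p q) \<subseteq> insert None (Some ` all_answers G))"

text \<open>\<open>marginal G p q S b\<close> is \<open>p\<^sub>q(a\<^sub>S)\<close> for \<open>a\<^sub>S = b\<close>; the mass of \<open>\<bottom>\<close> is not counted, not even for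
  \<open>S = \<emptyset>\<close>.\<close>

definition marginal ::
    "('q, 'a) game \<Rightarrow> ('q, 'a) strategy \<Rightarrow> (nat \<Rightarrow> 'q) \<Rightarrow> nat set \<Rightarrow> (nat \<Rightarrow> 'a) \<Rightarrow> real" where
  "marginal G p q S b = (\<Sum>a\<in>{a \<in> all_answers G. restrict a S = b}. pmf (p q) (Some a))"

definition is_simulator ::
    "('q, 'a) game \<Rightarrow> (nat set \<Rightarrow> (nat \<Rightarrow> 'q) \<Rightarrow> (nat \<Rightarrow> 'a) pmf) \<Rightarrow> bool" where
  "is_simulator G Sim \<longleftrightarrow>
     (\<forall>S\<subseteq>players G. \<forall>q\<in>questions_on G S. set_pmf (Sim S q) \<subseteq> answers_on G S)"

definition NS :: "('q, 'a) game \<Rightarrow> ('q, 'a) strategy set" where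
  "NS G = {p. is_strategy G p \<and>
     (\<exists>Sim. is_simulator G Sim \<and>
       (\<forall>q\<in>all_questions G. \<forall>S\<subseteq>players G. \<forall>b\<in>answers_on G S.
          marginal G p q S b = pmf (Sim S (restrict q S)) b))}"

definition subNS :: "('q, 'a) game \<Rightarrow> ('q, 'a) strategy set" where
  "subNS G = {p. is_strategy G p \<and>
     (\<exists>Sim. is_simulator G Sim \<and>
       (\<forall>q\<in>all_questions G. \<forall>S\<subseteq>players G. \<forall>b\<in>answers_on G S.
          marginal G p q S b \<le> pmf (Sim S (restrict q S)) b))}"

definition subNS_delta :: "real \<Rightarrow> ('q, 'a) game \<Rightarrow> ('q, 'a) strategy set" where
  "subNS_delta \<delta> G = {p \<in> subNS G. \<forall>q\<in>all_questions G. pmf (p q) None \<le> \<delta>}"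

definition win_prob :: "('q, 'a) game \<Rightarrow> ('q, 'a) strategy \<Rightarrow> real" where
  "win_prob G p =
     (\<Sum>q\<in>all_questions G. pmf (query_dist G) q *
        (\<Sum>a\<in>all_answers G. pmf (p q) (Some a) * of_bool (verdict G q a)))"

text \<open>
  The maximum over a class of strategies is written as a supremum.  For the classes above (with
  \<open>0 \<le> \<delta>\<close>) it is attained, as they are compact up to the irrelevant values of a strategy outside
  \<open>\<Q>\<close>; nonemptiness and boundedness are shown below.
\<close>

definition game_value :: "('q, 'a) game \<Rightarrow> ('q, 'a) strategy set \<Rightarrow> real" where
  "game_value G C = (SUP p\<in>C. win_prob G p)"

definition value_NS :: "('q, 'a) game \<Rightarrow> real" where
  "value_NS G = game_value G (NS G)"

definition value_subNS :: "('q, 'a) game \<Rightarrow> real" where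
  "value_subNS G = game_value G (subNS G)"

definition value_subNS_delta :: "real \<Rightarrow> ('q, 'a) game \<Rightarrow> real" where
  "value_subNS_delta \<delta> G = game_value G (subNS_delta \<delta> G)"

lemma finite_all_questions: "is_game G \<Longrightarrow> finite (all_questions G)"
  by (auto simp: is_game_def questions_on_def players_def intro!: finite_PiE)

lemma finite_all_answers: "is_game G \<Longrightarrow> finite (all_answers G)"
  by (auto simp: is_game_def answers_on_def players_def intro!: finite_PiE)

lemma win_prob_le_1:
  assumes "is_game G"
  shows "win_prob G p \<le> 1"
proof -
  have *: "(\<Sum>a\<in>all_answers G. pmf (p q) (Some a) * of_bool (verdict G q a)) \<le> 1" for q
  proof -
    have "(\<Sum>a\<in>all_answers G. pmf (p q) (Some a) * of_bool (verdict G q a))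
        \<le> (\<Sum>a\<in>all_answers G. pmf (p q) (Some a))"
      by (intro sum_mono) (auto simp: of_bool_def)
    also have "\<dots> = (\<Sum>x\<in>Some ` all_answers G. pmf (p q) x)"
      by (simp add: sum.reindex)
    also have "\<dots> = measure_pmf.prob (p q) (Some ` all_answers G)"
      by (simp add: measure_measure_pmf_finite finite_all_answers[OF assms])
    also have "\<dots> \<le> 1" by simp
    finally show ?thesis .
  qed
  have "win_prob G p \<le> (\<Sum>q\<in>all_questions G. pmf (query_dist G) q * 1)"
    unfolding win_prob_def by (intro sum_mono mult_left_mono *) auto
  also have "\<dots> = measure_pmf.prob (query_dist G) (all_questions G)"
    by (simp add: measure_measure_pmf_finite finite_all_questions[OF assms])
  also have "\<dots> \<le> 1" by simp
  finally show ?thesis .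
qed

lemma bdd_above_win_prob: "is_game G \<Longrightarrow> bdd_above (win_prob G ` C)"
  by (meson bdd_aboveI2 win_prob_le_1)

lemma NS_nonempty:
  assumes "is_game G"
  shows "NS G \<noteq> {}"
proof -
  define f where "f = (\<lambda>i. SOME x. x \<in> answers G i)"
  have f: "f i \<in> answers G i" if "i \<in> players G" for i
    using assms that unfolding f_def is_game_def by (simp add: some_in_eq)
  define a where "a = (\<lambda>S. restrict f S)"
  have a: "a S \<in> answers_on G S" if "S \<subseteq> players G" for S
    using f that by (auto simp: a_def answers_on_def)
  define p :: "('a, 'b) strategy" where "p = (\<lambda>q. return_pmf (Some (a (players G))))"
  have "marginal G p q S b = pmf (return_pmf (a S)) b" if "S \<subseteq> players G" for q S b
  proof -
    have r: "restrict (a (players G)) S = a S"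
      using that by (auto simp: a_def Int_absorb1)
    let ?I = "{x \<in> all_answers G. restrict x S = b}"
    have "marginal G p q S b = (\<Sum>x\<in>?I. if x = a (players G) then 1 else 0)"
      unfolding marginal_def p_def by (intro sum.cong) (auto simp: indicator_def)
    also have "\<dots> = (if a (players G) \<in> ?I then 1 else 0)"
      using finite_all_answers[OF assms] by (subst sum.delta) auto
    also have "\<dots> = pmf (return_pmf (a S)) b"
      using a[of "players G"] r by (auto simp: indicator_def)
    finally show ?thesis .
  qed
  then have "p \<in> NS G"
    using a
    by (auto simp: NS_def is_strategy_def is_simulator_def p_def
        intro!: exI[of _ "\<lambda>S q. return_pmf (a S)"])
  then show ?thesis by blast
qed

lemma NS_subset_subNS: "NS G \<subseteq> subNS G"
  unfolding NS_def subNS_def by (auto 4 4 intro: order.eq_iff[THEN iffD1])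

lemma subNS_delta_subset: "subNS_delta \<delta> G \<subseteq> subNS G"
  by (auto simp: subNS_delta_def)

lemma NS_subset_subNS_delta:
  assumes "is_game G" "0 \<le> \<delta>"
  shows "NS G \<subseteq> subNS_delta \<delta> G"
proof
  fix p assume p: "p \<in> NS G"
  have "pmf (p q) None \<le> \<delta>" if q: "q \<in> all_questions G" for q
  proof -
    obtain Sim where S: "is_simulator G Sim"
      and m: "\<forall>q\<in>all_questions G. \<forall>S\<subseteq>players G. \<forall>b\<in>answers_on G S.
          marginal G p q S b = pmf (Sim S (restrict q S)) b"
      using p by (auto simp: NS_def)
    let ?e = "\<lambda>_. undefined"
    have "set_pmf (Sim {} ?e) \<subseteq> {?e}"
      using S[unfolded is_simulator_def, rule_format, of "{}" ?e]
      by (simp add: questions_on_def answers_on_def)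
    then have "pmf (Sim {} ?e) ?e = 1"
      by (metis pmf_return set_pmf_subset_singleton indicator_simps(1) singletonI)
    moreover have "marginal G p q {} ?e = pmf (Sim {} ?e) ?e"
      using m q by (force simp: answers_on_def restrict_def)
    ultimately have "(\<Sum>a\<in>all_answers G. pmf (p q) (Some a)) = 1"
      by (simp add: marginal_def restrict_def)
    then have "(\<Sum>x\<in>Some ` all_answers G. pmf (p q) x) = 1"
      by (simp add: sum.reindex)
    moreover have "(\<Sum>x\<in>insert None (Some ` all_answers G). pmf (p q) x) \<le> 1"
      using finite_all_answers[OF assms(1)]
      by (subst measure_measure_pmf_finite[symmetric]) auto
    ultimately show ?thesis
      using finite_all_answers[OF assms(1)] assms(2) by simp
  qed
  then show "p \<in> subNS_delta \<delta> G"
    using p NS_subset_subNS by (auto simp: subNS_delta_def)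
qed

end

theory Submission
  imports Defs
begin

text \<open>
  Fix a sub-non-signaling strategy \<open>p\<close> with simulators \<open>\<sigma>\<^sub>T\<close> and put \<open>z = 2k\<close>.  By recursion on
  \<open>T\<close>, shrink \<open>\<sigma>\<^sub>T\<close> pointwise to \<open>M\<^sub>T \<le> \<sigma>\<^sub>T\<close>, as little as needed for every marginal of \<open>M\<^sub>T\<close> on
  \<open>U \<subset> T\<close> to lie below \<open>M\<^sub>U\<close>.  Since \<open>p\<^sub>q\<close> lies below all the \<open>\<sigma>\<^sub>T\<close> and has mass
  \<open>1 - p\<^sub>q(\<bottom>)\<close>, the mass lost on the way is at most \<open>p\<^sub>q(\<bottom>) z\<^bsup>|T|\<^esup>\<close>.

  The measure \<open>\<Sum>\<^bsub>U \<subseteq> T\<^esub> (-1)\<^bsup>|T - U|\<^esup> M\<^sub>T|\<^sub>U \<otimes> \<Otimes>\<^bsub>j \<notin> U\<^esub> \<sigma>\<^sub>j\<close> has vanishing marginals on the sets not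
  containing \<open>T\<close>, so any combination of these over \<open>T\<close> is non-signaling.  With the weights
  \<open>z\<^bsup>-|T|\<^esup>\<close> the negative terms for \<open>U\<close> are absorbed, because \<open>M\<^sub>T|\<^sub>U \<le> M\<^sub>U\<close>, by the positive term
  of \<open>U\<close> itself.  Hence the combination is a non-signaling strategy that dominates
  \<open>z\<^bsup>-k\<^esup> M\<^bsub>[k]\<^esub>\<close>, and \<open>M\<^bsub>[k]\<^esub>\<close> wins almost as often as \<open>p\<close>.
\<close>

section \<open>Sums over power sets and the inequality that fixes the base of the weights\<close>

lemma sum_Pow_insert:
  assumes "i \<notin> S" "finite S"
  shows "sum f (Pow (insert i S)) = sum f (Pow S) + (\<Sum>T\<in>Pow S. f (insert i T))"
proof -
  have "inj_on (insert i) (Pow S)" using assms by (auto simp: inj_on_def)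
  moreover have "Pow S \<inter> insert i ` Pow S = {}" using assms by auto
  ultimately show ?thesis
    using assms by (simp add: Pow_insert sum.union_disjoint sum.reindex)
qed

lemma sum_power_card_Pow:
  fixes z :: "'a::comm_ring_1"
  assumes "finite S"
  shows "(\<Sum>T\<in>Pow S. z ^ card T) = (z + 1) ^ card S"
  using assms
proof (induction S rule: finite_induct)
  case (insert i S)
  have "(\<Sum>T\<in>Pow S. z ^ card (insert i T)) = z * (\<Sum>T\<in>Pow S. z ^ card T)"
    unfolding sum_distrib_left using insert.hyps
    by (intro sum.cong refl) (auto simp: finite_subset card_insert_if)
  then show ?case
    using insert by (simp add: sum_Pow_insert algebra_simps)
qed simp

text \<open>Bernoulli's inequality for \<open>z / (z + 1) = 1 - 1 / (z + 1)\<close>. This is the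
  reason for the base \<open>2 * card I\<close>: it closes both the comparison of weights and the
  recursion for the lost mass.\<close>

lemma power_succ_le_double:
  fixes z :: real
  assumes "2 * real n \<le> z"
  shows "(z + 1) ^ n \<le> 2 * z ^ n"
proof (cases "z = 0")
  case True
  then show ?thesis using assms by simp
next
  case False
  have z: "z > 0" using assms False by (smt (verit) of_nat_0_le_iff)
  have "1 / 2 \<le> 1 + real n * (- 1 / (z + 1))"
    using assms z by (simp add: field_simps)
  also have "\<dots> \<le> (1 + - 1 / (z + 1)) ^ n"
    using z by (intro Bernoulli_inequality) (simp add: field_simps)
  also have "1 + - 1 / (z + 1) = z / (z + 1)"
    using z by (simp add: field_simps)
  finally show ?thesis
    using z by (simp add: power_divide field_simps)
qed

section \<open>Marginals of real functions on finite products\<close>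

locale finite_answers =
  fixes I :: "'i set" and A :: "'i \<Rightarrow> 'a set"
  assumes finite_I: "finite I" and finite_A: "i \<in> I \<Longrightarrow> finite (A i)"
begin

text \<open>The domain \<open>T\<close> is an argument because \<open>f\<close> is total and its
  values outside \<open>PiE T A\<close> carry no meaning; \<open>U\<close> is the set that is
  kept.\<close>

definition marg :: "'i set \<Rightarrow> 'i set \<Rightarrow> (('i \<Rightarrow> 'a) \<Rightarrow> real) \<Rightarrow> ('i \<Rightarrow> 'a) \<Rightarrow> real" where
  "marg T U f b = (\<Sum>a\<in>{a \<in> PiE T A. restrict a U = b}. f a)"

lemma finite_subset_I: "T \<subseteq> I \<Longrightarrow> finite T"
  by (rule finite_subset[OF _ finite_I])

lemma finite_PiE_A: "T \<subseteq> I \<Longrightarrow> finite (PiE T A)"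
  using finite_I finite_A by (auto intro!: finite_PiE intro: finite_subset)

lemma restrict_PiE_A: "a \<in> PiE T A \<Longrightarrow> U \<subseteq> T \<Longrightarrow> restrict a U \<in> PiE U A"
  by auto

lemma marg_self: "b \<in> PiE T A \<Longrightarrow> marg T T f b = f b"
proof -
  assume b: "b \<in> PiE T A"
  have "{a \<in> PiE T A. restrict a T = b} = {b}"
    using b by (auto simp: PiE_restrict)
  then show ?thesis by (simp add: marg_def)
qed

lemma marg_nonneg: "(\<And>a. a \<in> PiE T A \<Longrightarrow> 0 \<le> f a) \<Longrightarrow> 0 \<le> marg T U f b"
  unfolding marg_def by (rule sum_nonneg) auto

lemma marg_mono: "(\<And>a. a \<in> PiE T A \<Longrightarrow> f a \<le> g a) \<Longrightarrow> marg T U f b \<le> marg T U g b"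
  unfolding marg_def by (rule sum_mono) auto

lemma sum_marg:
  assumes "U \<subseteq> T" "T \<subseteq> I"
  shows "(\<Sum>b\<in>PiE U A. marg T U f b) = sum f (PiE T A)"
  unfolding marg_def using assms finite_PiE_A[of T] finite_PiE_A[of U]
  by (intro sum.group) auto

lemma marg_marg:
  assumes "U \<subseteq> V" "V \<subseteq> T" "T \<subseteq> I"
  shows "marg V U (marg T V f) b = marg T U f b"
proof -
  let ?S = "{a \<in> PiE T A. restrict a U = b}" and ?R = "{c \<in> PiE V A. restrict c U = b}"
  have "marg V U (marg T V f) b = (\<Sum>c\<in>?R. \<Sum>a\<in>{a\<in>?S. restrict a V = c}. f a)"
    unfolding marg_def using assms
    by (intro sum.cong refl) (auto simp: Int_absorb1)
  also have "\<dots> = sum f ?S"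
    using assms finite_PiE_A[of T] finite_PiE_A[of V]
    by (intro sum.group) (auto simp: Int_absorb1)
  finally show ?thesis by (simp add: marg_def)
qed

lemma marg_insert:
  assumes "i \<notin> S" "b \<in> PiE S A"
  shows "marg (insert i S) S f b = (\<Sum>x\<in>A i. f (b(i := x)))"
  unfolding marg_def
proof (rule sum.reindex_bij_witness[of _ "\<lambda>x. b(i := x)" "\<lambda>a. a i"])
  fix a assume "a \<in> {a \<in> PiE (insert i S) A. restrict a S = b}"
  then have a: "a \<in> PiE (insert i S) A" "restrict a S = b" by auto
  show "b(i := a i) = a"
    using a(1) assms(1) by (auto simp: fun_eq_iff a(2)[symmetric] PiE_def extensional_def)
  then show "f (b(i := a i)) = f a" by simp
  show "a i \<in> A i" using a by auto
next
  fix x assume "x \<in> A i"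
  then show "b(i := x) \<in> {a \<in> PiE (insert i S) A. restrict a S = b}"
    using assms by (auto simp: fun_eq_iff restrict_def PiE_def extensional_def)
qed simp

text \<open>The tower property for one coordinate. The tuple \<open>b\<close> may live on a larger
  set \<open>R\<close>, because \<open>summand\<close> evaluates all marginals at restrictions of
  one tuple.\<close>

lemma marg_insert_restrict:
  assumes "i \<notin> S" "insert i S \<subseteq> T" "T \<subseteq> I" "S \<subseteq> R" "b \<in> PiE R A"
  shows "marg T S f (restrict b S) =
    (\<Sum>x\<in>A i. marg T (insert i S) f (restrict (b(i := x)) (insert i S)))"
proof -
  have r: "(restrict b S)(i := x) = restrict (b(i := x)) (insert i S)" for x
    using assms(1) by (auto simp: fun_eq_iff)
  have "marg T S f (restrict b S) = marg (insert i S) S (marg T (insert i S) f) (restrict b S)"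
    using assms by (intro marg_marg[symmetric]) auto
  also have "\<dots> = (\<Sum>x\<in>A i. marg T (insert i S) f ((restrict b S)(i := x)))"
    using assms by (intro marg_insert) auto
  finally show ?thesis by (simp only: r)
qed

section \<open>Shrinking the simulators until their marginals are ordered\<close>

definition distributions :: "'i set \<Rightarrow> ('i set \<Rightarrow> ('i \<Rightarrow> 'a) \<Rightarrow> real) \<Rightarrow> bool" where
  "distributions S \<sigma> \<longleftrightarrow>
     (\<forall>T\<subseteq>S. (\<forall>a\<in>PiE T A. 0 \<le> \<sigma> T a) \<and> sum (\<sigma> T) (PiE T A) = 1)"

lemma distributionsD:
  assumes "distributions S \<sigma>" "T \<subseteq> S"
  shows "a \<in> PiE T A \<Longrightarrow> 0 \<le> \<sigma> T a" "sum (\<sigma> T) (PiE T A) = 1"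
  using assms by (auto simp: distributions_def)

lemma distributions_subset: "distributions S \<sigma> \<Longrightarrow> T \<subseteq> S \<Longrightarrow> distributions T \<sigma>"
  by (auto simp: distributions_def)

text \<open>The quotient for \<open>U\<close> is the share of the fibre over
  \<open>restrict a U\<close> that may be kept. The \<open>1\<close> keeps the result below
  \<open>\<sigma> T\<close> and the set nonempty at \<open>T = {}\<close>. A vanishing denominator
  gives quotient 0, which costs nothing: for nonnegative \<open>\<sigma> T\<close> and
  \<open>a\<close> in the product, \<open>\<sigma> T a\<close> is then 0 too.\<close>

function trunc :: "('i set \<Rightarrow> ('i \<Rightarrow> 'a) \<Rightarrow> real) \<Rightarrow> 'i set \<Rightarrow> ('i \<Rightarrow> 'a) \<Rightarrow> real" where
  "trunc \<sigma> T a = (if finite T then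
     \<sigma> T a * Min (insert 1 ((\<lambda>U. trunc \<sigma> U (restrict a U) / marg T U (\<sigma> T) (restrict a U))
                           ` {U. U \<subset> T}))
     else 0)"
  by auto
termination
  by (relation "Wellfounded.measure (\<lambda>(\<sigma>, T, a). card T)") (auto intro: psubset_card_mono)

declare trunc.simps [simp del]

lemma trunc_cong:
  assumes "\<And>T. T \<subseteq> S \<Longrightarrow> \<sigma> T = \<tau> T" "finite S"
  shows "trunc \<sigma> S a = trunc \<tau> S a"
  using assms(2,1)
proof (induction S arbitrary: a rule: finite_psubset_induct)
  case (psubset S)
  have IH: "trunc \<sigma> U b = trunc \<tau> U b" if "U \<subset> S" for U b
    by (rule psubset.IH[OF that]) (use that psubset.prems in blast)
  have "(\<lambda>U. trunc \<sigma> U (restrict a U) / marg S U (\<sigma> S) (restrict a U)) ` {U. U \<subset> S} =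
        (\<lambda>U. trunc \<tau> U (restrict a U) / marg S U (\<tau> S) (restrict a U)) ` {U. U \<subset> S}"
    by (intro image_cong) (simp_all add: IH psubset.prems)
  then show ?case
    by (simp only: trunc.simps[of \<sigma> S a] trunc.simps[of \<tau> S a] psubset.prems[OF subset_refl])
qed

definition factor :: "('i set \<Rightarrow> ('i \<Rightarrow> 'a) \<Rightarrow> real) \<Rightarrow> 'i set \<Rightarrow> ('i \<Rightarrow> 'a) \<Rightarrow> real" where
  "factor \<sigma> T a = Min (insert 1 ((\<lambda>U. trunc \<sigma> U (restrict a U) / marg T U (\<sigma> T) (restrict a U))
                           ` {U. U \<subset> T}))"

lemma trunc_eq: "finite T \<Longrightarrow> trunc \<sigma> T a = \<sigma> T a * factor \<sigma> T a"
  by (subst trunc.simps) (simp add: factor_def)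

lemma finite_psubsets: "finite T \<Longrightarrow> finite {U. U \<subset> T}"
  by (rule finite_subset[of _ "Pow T"]) auto

lemma factor_le_1: "finite T \<Longrightarrow> factor \<sigma> T a \<le> 1"
  unfolding factor_def by (rule Min_le) (auto simp: finite_psubsets)

lemma factor_le:
  "finite T \<Longrightarrow> U \<subset> T \<Longrightarrow>
    factor \<sigma> T a \<le> trunc \<sigma> U (restrict a U) / marg T U (\<sigma> T) (restrict a U)"
  unfolding factor_def by (rule Min_le) (auto simp: finite_psubsets)

lemma trunc_nonneg:
  assumes "distributions S \<sigma>" "finite S" "a \<in> PiE S A"
  shows "0 \<le> trunc \<sigma> S a"
  using assms(2,1,3)
proof (induction S arbitrary: a rule: finite_psubset_induct)
  case (psubset S)
  have "0 \<le> trunc \<sigma> U (restrict a U) / marg S U (\<sigma> S) (restrict a U)" if U: "U \<subset> S" for U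
  proof (rule divide_nonneg_nonneg)
    show "0 \<le> trunc \<sigma> U (restrict a U)"
      using psubset.prems U by (intro psubset.IH distributions_subset[OF psubset.prems(1)]) auto
    show "0 \<le> marg S U (\<sigma> S) (restrict a U)"
      using psubset.prems by (intro marg_nonneg distributionsD(1)[of S]) auto
  qed
  then have "0 \<le> factor \<sigma> S a"
    unfolding factor_def using finite_psubsets[OF psubset.hyps]
    by (intro Min.boundedI) (auto simp del: zero_le_divide_iff)
  then show ?case
    using distributionsD(1)[OF psubset.prems(1), of S a] psubset.prems psubset.hyps
    by (simp add: trunc_eq)
qed

lemma trunc_le:
  assumes "distributions S \<sigma>" "finite S" "a \<in> PiE S A"
  shows "trunc \<sigma> S a \<le> \<sigma> S a"
  using mult_left_mono[OF factor_le_1 distributionsD(1)[OF assms(1)], of S S a] assms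
  by (simp add: trunc_eq)

text \<open>The quotient for \<open>U\<close> is constant on the fibre over \<open>b\<close>, so it
  factors out of the fibre sum and meets its own denominator.\<close>

lemma marg_trunc_le:
  assumes "distributions T \<sigma>" "T \<subseteq> I" "U \<subseteq> T" "b \<in> PiE U A"
  shows "marg T U (trunc \<sigma> T) b \<le> trunc \<sigma> U b"
proof (cases "U = T")
  case True
  then show ?thesis using assms by (simp add: marg_self)
next
  case False
  then have U: "U \<subset> T" using assms by auto
  have fin: "finite T" using assms(2) by (rule finite_subset_I)
  let ?m = "marg T U (\<sigma> T) b"
  have "marg T U (trunc \<sigma> T) b \<le> (\<Sum>a\<in>{a \<in> PiE T A. restrict a U = b}. \<sigma> T a * (trunc \<sigma> U b / ?m))"
    unfolding marg_def[of T U "trunc \<sigma> T"]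
  proof (rule sum_mono)
    fix a assume a: "a \<in> {a \<in> PiE T A. restrict a U = b}"
    then show "trunc \<sigma> T a \<le> \<sigma> T a * (trunc \<sigma> U b / ?m)"
      unfolding trunc_eq[OF fin]
      using factor_le[OF fin U, of \<sigma> a] distributionsD(1)[OF assms(1), of T a]
      by (intro mult_left_mono) auto
  qed
  also have "\<dots> = ?m * (trunc \<sigma> U b / ?m)"
    by (simp only: sum_distrib_right marg_def)
  also have "\<dots> \<le> trunc \<sigma> U b"
    using trunc_nonneg[OF distributions_subset[OF assms(1,3)], of b] assms(4)
      finite_subset[OF assms(3) fin] by (cases "?m = 0") auto
  finally show ?thesis .
qed

section \<open>Gluing the shrunk simulators with alternating signs\<close>

text \<open>The marginal identities for \<open>glue\<close> hold for any weight. This value serves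
  positivity: all proper supersets of a set together must not outweigh the set itself.\<close>

definition weight :: real where
  "weight = 1 / (2 * real (card I))"

text \<open>An inclusion-exclusion term: the players in \<open>U\<close> answer by the marginal of
  the measure for \<open>T\<close>, all others in \<open>S\<close> independently by their
  single-player simulators. With \<open>S\<close> as a parameter, marginals of a \<open>glue\<close>
  are again a \<open>glue\<close>.\<close>

definition summand ::
    "('i set \<Rightarrow> ('i \<Rightarrow> 'a) \<Rightarrow> real) \<Rightarrow> 'i set \<Rightarrow> 'i set \<Rightarrow> 'i set \<Rightarrow> ('i \<Rightarrow> 'a) \<Rightarrow> real" where
  "summand \<sigma> S T U b = (-1) ^ card (T - U) * marg T U (trunc \<sigma> T) (restrict b U) *
     (\<Prod>j\<in>S - U. \<sigma> {j} (restrict b {j}))"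

text \<open>The term \<open>T = \<emptyset>\<close> is the product of the single-player simulators; all other terms have total
  mass \<open>0\<close>.\<close>

definition glue :: "('i set \<Rightarrow> ('i \<Rightarrow> 'a) \<Rightarrow> real) \<Rightarrow> 'i set \<Rightarrow> ('i \<Rightarrow> 'a) \<Rightarrow> real" where
  "glue \<sigma> S b = (\<Sum>T\<in>Pow S. weight ^ card T * (\<Sum>U\<in>Pow T. summand \<sigma> S T U b))"

text \<open>Locality, the source of non-signaling: in a game the simulators of subsets of
  \<open>S\<close> see only the questions to \<open>S\<close>.\<close>

lemma glue_cong:
  assumes "\<And>T. T \<subseteq> S \<Longrightarrow> \<sigma> T = \<tau> T" "finite S"
  shows "glue \<sigma> S b = glue \<tau> S b"
proof -
  have "summand \<sigma> S T U b = summand \<tau> S T U b" if "T \<subseteq> S" for T U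
  proof -
    have "trunc \<sigma> T = trunc \<tau> T"
      using assms that by (intro ext trunc_cong) (auto intro: finite_subset)
    moreover have "\<sigma> {j} = \<tau> {j}" if "j \<in> S" for j
      using assms(1) that by auto
    ultimately show ?thesis by (simp add: summand_def)
  qed
  then show ?thesis by (simp add: glue_def)
qed

lemma sum_singleton_extension:
  assumes "distributions (insert i S) \<sigma>"
  shows "(\<Sum>x\<in>A i. \<sigma> {i} (restrict (b(i := x)) {i})) = 1"
proof -
  have "(\<Sum>x\<in>A i. \<sigma> {i} (restrict (b(i := x)) {i})) = sum (\<sigma> {i}) (PiE {i} A)"
    by (rule sum.reindex_bij_witness[of _ "\<lambda>a. a i" "\<lambda>x. restrict (b(i := x)) {i}"])
      (auto simp: fun_eq_iff PiE_def extensional_def)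
  then show ?thesis using distributionsD(2)[OF assms, of "{i}"] by simp
qed

text \<open>Split the top sets by membership of \<open>i\<close>. Without \<open>i\<close>, the only
  trace of \<open>i\<close> is the factor \<open>\<sigma> {i}\<close>, which sums to 1 and leaves
  the term for \<open>S\<close>. With \<open>i\<close>, the terms cancel in pairs of opposite
  sign.\<close>

lemma marg_glue_insert:
  assumes "distributions (insert i S) \<sigma>" "insert i S \<subseteq> I" "i \<notin> S" "b \<in> PiE S A"
  shows "(\<Sum>x\<in>A i. glue \<sigma> (insert i S) (b(i := x))) = glue \<sigma> S b"
proof -
  have fin: "finite S" using assms(2) by (simp add: finite_subset_I)
  let ?s = "\<lambda>T U x. summand \<sigma> (insert i S) T U (b(i := x))"
  let ?p = "\<lambda>U. \<Prod>j\<in>S - U. \<sigma> {j} (restrict b {j})"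
  have r: "restrict (b(i := x)) U = restrict b U" if "U \<subseteq> S" for U x
    using that assms(3) by (auto simp: fun_eq_iff restrict_def)
  have p: "(\<Prod>j\<in>S - U. \<sigma> {j} (restrict (b(i := x)) {j})) = ?p U" for U x
    using assms(3) by (intro prod.cong refl) (simp add: r)
  have p': "(\<Prod>j\<in>insert i S - U. \<sigma> {j} (restrict (b(i := x)) {j})) =
      \<sigma> {i} (restrict (b(i := x)) {i}) * ?p U" if "U \<subseteq> S" for U x
  proof -
    have "insert i S - U = insert i (S - U)" using that assms(3) by auto
    then show ?thesis using assms(3) fin p by simp
  qed
  have avg: "(\<Sum>x\<in>A i. \<sigma> {i} (restrict (b(i := x)) {i}) * c) = c" for c
    using sum_singleton_extension[OF assms(1), of b] by (simp flip: sum_distrib_right)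
  have swap: "(\<Sum>x\<in>A i. \<Sum>T\<in>Pow S. c T * (\<Sum>U\<in>Pow T. f T U x)) =
      (\<Sum>T\<in>Pow S. c T * (\<Sum>U\<in>Pow T. \<Sum>x\<in>A i. f T U x))"
    for c and f :: "'i set \<Rightarrow> 'i set \<Rightarrow> 'a \<Rightarrow> real"
  proof -
    have "(\<Sum>x\<in>A i. \<Sum>T\<in>Pow S. c T * (\<Sum>U\<in>Pow T. f T U x)) =
        (\<Sum>T\<in>Pow S. \<Sum>x\<in>A i. c T * (\<Sum>U\<in>Pow T. f T U x))"
      by (rule sum.swap)
    also have "\<dots> = (\<Sum>T\<in>Pow S. c T * (\<Sum>x\<in>A i. \<Sum>U\<in>Pow T. f T U x))"
      by (simp only: sum_distrib_left)
    also have "\<dots> = (\<Sum>T\<in>Pow S. c T * (\<Sum>U\<in>Pow T. \<Sum>x\<in>A i. f T U x))"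
      by (subst sum.swap) (rule refl)
    finally show ?thesis .
  qed
  have 1: "(\<Sum>x\<in>A i. ?s T U x) = summand \<sigma> S T U b" if "T \<subseteq> S" "U \<subseteq> T" for T U
  proof -
    have "U \<subseteq> S" using that by auto
    then have "(\<Sum>x\<in>A i. ?s T U x) =
        (\<Sum>x\<in>A i. \<sigma> {i} (restrict (b(i := x)) {i}) * summand \<sigma> S T U b)"
      by (intro sum.cong refl) (simp add: summand_def r p' mult_ac)
    then show ?thesis by (simp only: avg)
  qed
  \<comment> \<open>if \<open>i\<close> is in the top set, the terms for \<open>U\<close> and \<open>U \<union> {i}\<close> cancel after summing out \<open>i\<close>\<close>
  have 2: "(\<Sum>x\<in>A i. ?s (insert i T) U x + ?s (insert i T) (insert i U) x) = 0"
    if "T \<subseteq> S" "U \<subseteq> T" for T U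
  proof -
    have US: "U \<subseteq> S" using that by auto
    have finT: "finite T" using that fin finite_subset by blast
    let ?e = "(-1) ^ card (T - U) :: real"
    let ?m = "\<lambda>x. marg (insert i T) (insert i U) (trunc \<sigma> (insert i T))
      (restrict (b(i := x)) (insert i U))"
    let ?m' = "marg (insert i T) U (trunc \<sigma> (insert i T)) (restrict b U)"
    have "insert i T - U = insert i (T - U)" "i \<notin> T - U" using that assms(3) by auto
    then have c1: "(-1) ^ card (insert i T - U) = - ?e" using finT by simp
    have "insert i T - insert i U = T - U" "insert i S - insert i U = S - U"
      using that assms(3) by auto
    then have "(\<Sum>x\<in>A i. ?s (insert i T) (insert i U) x) = (\<Sum>x\<in>A i. ?m x * (?e * ?p U))"
      by (intro sum.cong refl) (simp only: summand_def p mult_ac)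
    also have "\<dots> = ?m' * (?e * ?p U)"
      using that assms by (subst marg_insert_restrict[where i = i and R = S])
        (auto simp: sum_distrib_right)
    moreover have "(\<Sum>x\<in>A i. ?s (insert i T) U x) =
        (\<Sum>x\<in>A i. \<sigma> {i} (restrict (b(i := x)) {i}) * (- (?m' * (?e * ?p U))))"
      by (intro sum.cong refl) (simp add: summand_def c1 r[OF US] p'[OF US] mult_ac)
    ultimately show ?thesis by (simp only: sum.distrib avg)
  qed
  \<comment> \<open>The top set is split by membership of \<open>i\<close>; when it contains
    \<open>i\<close>, so is its subset \<open>U\<close>.\<close>
  have "(\<Sum>x\<in>A i. glue \<sigma> (insert i S) (b(i := x))) =
     (\<Sum>x\<in>A i. (\<Sum>T\<in>Pow S. weight ^ card T * (\<Sum>U\<in>Pow T. ?s T U x)) +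
       (\<Sum>T\<in>Pow S. weight ^ card (insert i T) *
          (\<Sum>U\<in>Pow T. ?s (insert i T) U x + ?s (insert i T) (insert i U) x)))"
  proof (intro sum.cong refl)
    fix x
    have "(\<Sum>U\<in>Pow (insert i T). ?s (insert i T) U x) =
        (\<Sum>U\<in>Pow T. ?s (insert i T) U x + ?s (insert i T) (insert i U) x)" if "T \<in> Pow S" for T
      using that assms(3) fin finite_subset[of T S]
      by (subst sum_Pow_insert) (auto simp: sum.distrib)
    then show "glue \<sigma> (insert i S) (b(i := x)) =
       (\<Sum>T\<in>Pow S. weight ^ card T * (\<Sum>U\<in>Pow T. ?s T U x)) +
       (\<Sum>T\<in>Pow S. weight ^ card (insert i T) *
          (\<Sum>U\<in>Pow T. ?s (insert i T) U x + ?s (insert i T) (insert i U) x))"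
      unfolding glue_def using assms(3) fin by (subst sum_Pow_insert) auto
  qed
  also have "\<dots> = (\<Sum>T\<in>Pow S. weight ^ card T * (\<Sum>U\<in>Pow T. \<Sum>x\<in>A i. ?s T U x)) +
       (\<Sum>T\<in>Pow S. weight ^ card (insert i T) *
          (\<Sum>U\<in>Pow T. \<Sum>x\<in>A i. ?s (insert i T) U x + ?s (insert i T) (insert i U) x))"
    by (simp only: sum.distrib[where A = "A i"] swap)
  also have "\<dots> = glue \<sigma> S b"
    by (simp add: glue_def 1 2)
  finally show ?thesis .
qed

text \<open>The players in \<open>S - R\<close> are summed out one at a time. What remains involves
  only simulators of subsets of \<open>R\<close>.\<close>

lemma marg_glue:
  assumes "distributions S \<sigma>" "S \<subseteq> I" "R \<subseteq> S" "b \<in> PiE R A"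
  shows "marg S R (glue \<sigma> S) b = glue \<sigma> R b"
proof -
  have "finite (S - R)" using finite_subset_I[OF assms(2)] by simp
  then show ?thesis using assms
  proof (induction "S - R" arbitrary: S rule: finite_induct)
    case empty
    then have "S = R" by auto
    then show ?case using empty by (simp add: marg_self)
  next
    case (insert i D)
    define V where "V = S - {i}"
    have S: "S = insert i V" "i \<notin> V" "R \<subseteq> V" "D = V - R"
      using insert.hyps insert.prems by (auto simp: V_def)
    have "marg S R (glue \<sigma> S) b = marg V R (marg S V (glue \<sigma> S)) b"
      using S insert.prems by (intro marg_marg[symmetric]) auto
    also have "\<dots> = marg V R (glue \<sigma> V) b"
      unfolding marg_def[of V R]
    proof (rule sum.cong[OF refl])
      fix c assume "c \<in> {a \<in> PiE V A. restrict a R = b}"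
      then have c: "c \<in> PiE V A" by auto
      show "marg S V (glue \<sigma> S) c = glue \<sigma> V c"
        using S insert.prems c by (simp add: marg_insert marg_glue_insert)
    qed
    also have "\<dots> = glue \<sigma> R b"
      using S insert.prems by (intro insert.hyps) (auto intro: distributions_subset)
    finally show ?case .
  qed
qed

lemma trunc_empty: "distributions {} \<sigma> \<Longrightarrow> trunc \<sigma> {} (\<lambda>_. undefined) = 1"
  using distributionsD(2)[of "{}" \<sigma> "{}"] by (simp add: trunc_eq factor_def)

text \<open>The total mass is the marginal on no players, where only \<open>T = U = {}\<close> is
  left.\<close>

lemma sum_glue:
  assumes "distributions S \<sigma>" "S \<subseteq> I"
  shows "sum (glue \<sigma> S) (PiE S A) = 1"
proof -
  have e: "(\<lambda>_. undefined) \<in> PiE {} A" by simp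
  have "sum (glue \<sigma> S) (PiE S A) = marg S {} (glue \<sigma> S) (\<lambda>_. undefined)"
    by (auto simp: marg_def restrict_def intro!: sum.cong)
  also have "\<dots> = glue \<sigma> {} (\<lambda>_. undefined)"
    using marg_glue[OF assms _ e] by simp
  also have "\<dots> = 1"
    using marg_self[OF e] trunc_empty distributions_subset[OF assms(1), of "{}"]
    by (simp add: glue_def summand_def restrict_def)
  finally show ?thesis .
qed

lemma weight_nonneg: "0 \<le> weight"
  by (simp add: weight_def)

text \<open>With \<open>T = U \<union> V\<close> and \<open>V\<close> nonempty, the binomial formula
  gives the factor \<open>(weight + 1) ^ card (S - U) - 1\<close>, at most 1 by
  \<open>power_succ_le_double\<close>.\<close>

lemma sum_supersets_le:
  assumes "U \<subseteq> S" "S \<subseteq> I" "I \<noteq> {}"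
  shows "(\<Sum>T\<in>{T\<in>Pow S. U \<subset> T}. weight ^ card T) \<le> weight ^ card U"
proof -
  have fin: "finite S" using assms(2) by (simp add: finite_subset_I)
  have fins: "finite U" "finite (S - U)" using fin assms finite_subset by auto
  have "(\<Sum>T\<in>{T\<in>Pow S. U \<subset> T}. weight ^ card T) =
      (\<Sum>V\<in>Pow (S - U) - {{}}. weight ^ card U * weight ^ card V)"
  proof (rule sum.reindex_bij_witness[of _ "\<lambda>V. U \<union> V" "\<lambda>T. T - U"])
    fix T assume "T \<in> {T\<in>Pow S. U \<subset> T}"
    then have T: "T \<subseteq> S" "U \<subset> T" by auto
    have "card T = card U + card (T - U)"
      using T fin card_mono[of T U] finite_subset[of T S] fins by (auto simp: card_Diff_subset)
    then show "weight ^ card U * weight ^ card (T - U) = weight ^ card T"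
      by (simp add: power_add)
  qed (use assms in auto)
  also have "\<dots> = weight ^ card U * ((weight + 1) ^ card (S - U) - 1)"
    using fins(2) by (simp add: sum_distrib_left[symmetric] sum_diff1 sum_power_card_Pow)
  also have "\<dots> \<le> weight ^ card U * 1"
  proof (intro mult_left_mono)
    have "card I > 0" using assms(3) finite_I by (simp add: card_gt_0_iff)
    moreover have "card (S - U) \<le> card I" using assms finite_I by (intro card_mono) auto
    ultimately have "((2 * real (card I) + 1) / (2 * real (card I))) ^ card (S - U) \<le> 2"
      using power_succ_le_double[of "card (S - U)" "2 * real (card I)"]
      by (simp add: power_divide divide_le_eq)
    moreover have "weight + 1 = (2 * real (card I) + 1) / (2 * real (card I))"
      using \<open>card I > 0\<close> by (simp add: weight_def add_divide_distrib)
    ultimately show "(weight + 1) ^ card (S - U) - 1 \<le> 1" by simp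
  qed (simp add: weight_nonneg)
  finally show ?thesis by simp
qed

text \<open>Collect terms by \<open>U\<close> instead of \<open>T\<close>. The term
  \<open>T = U\<close> is nonnegative; a proper superset \<open>T\<close> is at worst negative, with
  a marginal below \<open>trunc \<sigma> U\<close> and the same product factor. So each
  \<open>U\<close> keeps a nonnegative coefficient, which at \<open>U = S\<close> is the full
  \<open>weight ^ card S\<close>.\<close>

lemma glue_ge:
  assumes "distributions S \<sigma>" "S \<subseteq> I" "I \<noteq> {}" "b \<in> PiE S A"
  shows "weight ^ card S * trunc \<sigma> S b \<le> glue \<sigma> S b"
proof -
  have fin: "finite S" using assms(2) by (simp add: finite_subset_I)
  let ?M = "\<lambda>U. trunc \<sigma> U (restrict b U)" and ?p = "\<lambda>U. \<Prod>j\<in>S - U. \<sigma> {j} (restrict b {j})"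
  let ?W = "\<lambda>U. \<Sum>T\<in>{T\<in>Pow S. U \<subset> T}. weight ^ card T"
  have p: "0 \<le> ?p U" for U
    using assms(4) by (intro prod_nonneg ballI distributionsD(1)[OF assms(1)]) auto
  have M: "0 \<le> ?M U" if "U \<subseteq> S" for U
    by (intro trunc_nonneg distributions_subset[OF assms(1)] restrict_PiE_A[OF assms(4)]
        finite_subset[OF _ fin] that)
  have neg: "- (weight ^ card T * (?M U * ?p U)) \<le> weight ^ card T * summand \<sigma> S T U b"
    if "U \<subseteq> T" "T \<subseteq> S" for T U
  proof -
    let ?m = "marg T U (trunc \<sigma> T) (restrict b U)"
    have d: "distributions T \<sigma>" using distributions_subset[OF assms(1)] that by auto
    have "0 \<le> ?m"
      using that fin by (intro marg_nonneg trunc_nonneg d) (auto intro: finite_subset)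
    moreover have "?m \<le> ?M U"
      using that assms by (intro marg_trunc_le d) auto
    moreover have "(-1) ^ card (T - U) = (1 :: real) \<or> (-1) ^ card (T - U) = (-1 :: real)"
      by (simp add: neg_one_even_power minus_one_power_iff)
    ultimately have "- ?M U \<le> (-1) ^ card (T - U) * ?m"
      by auto
    then have "- ?M U * ?p U \<le> summand \<sigma> S T U b"
      unfolding summand_def by (intro mult_right_mono p)
    then show ?thesis
      using mult_left_mono[of "- ?M U * ?p U" "summand \<sigma> S T U b" "weight ^ card T"] weight_nonneg
      by simp
  qed
  have diag: "summand \<sigma> S U U b = ?M U * ?p U" if "U \<subseteq> S" for U
    using marg_self[OF restrict_PiE_A[OF assms(4) that]] by (simp add: summand_def)
  \<comment> \<open>The lower bound is padded with zeros to a sum over all \<open>U\<close> for a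
    termwise comparison.\<close>
  have "weight ^ card S * trunc \<sigma> S b = (\<Sum>U\<in>Pow S. if U = S then weight ^ card S * ?M S else 0)"
    using fin assms(4) by (simp add: PiE_restrict)
  also have "\<dots> \<le> (\<Sum>U\<in>Pow S. (weight ^ card U - ?W U) * (?M U * ?p U))"
  proof (rule sum_mono)
    fix U assume "U \<in> Pow S"
    then have U: "U \<subseteq> S" by auto
    show "(if U = S then weight ^ card S * ?M S else 0) \<le>
        (weight ^ card U - ?W U) * (?M U * ?p U)"
    proof (cases "U = S")
      case True
      have "{T \<in> Pow S. S \<subset> T} = {}" by auto
      then show ?thesis unfolding True by (simp only: sum.empty) simp
    next
      case False
      then show ?thesis
        using mult_nonneg_nonneg[OF _ mult_nonneg_nonneg[OF M[OF U] p[of U]]]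
          sum_supersets_le[OF U assms(2,3)] by simp
    qed
  qed
  also have "\<dots> = (\<Sum>U\<in>Pow S. weight ^ card U * summand \<sigma> S U U b +
      (\<Sum>T\<in>{T\<in>Pow S. U \<subset> T}. - (weight ^ card T * (?M U * ?p U))))"
    by (intro sum.cong refl)
      (simp add: diag left_diff_distrib sum_distrib_right sum_negf)
  also have "\<dots> \<le> (\<Sum>U\<in>Pow S. weight ^ card U * summand \<sigma> S U U b +
      (\<Sum>T\<in>{T\<in>Pow S. U \<subset> T}. weight ^ card T * summand \<sigma> S T U b))"
    by (intro sum_mono add_left_mono neg) auto
  also have "\<dots> = (\<Sum>U\<in>Pow S. \<Sum>T\<in>{T\<in>Pow S. U \<subseteq> T}. weight ^ card T * summand \<sigma> S T U b)"
  proof (intro sum.cong refl)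
    fix U assume "U \<in> Pow S"
    then have "{T\<in>Pow S. U \<subseteq> T} = insert U {T\<in>Pow S. U \<subset> T}" by auto
    then show "weight ^ card U * summand \<sigma> S U U b +
      (\<Sum>T\<in>{T\<in>Pow S. U \<subset> T}. weight ^ card T * summand \<sigma> S T U b) =
      (\<Sum>T\<in>{T\<in>Pow S. U \<subseteq> T}. weight ^ card T * summand \<sigma> S T U b)"
      using fin by simp
  qed
  also have "\<dots> = (\<Sum>T\<in>Pow S. \<Sum>U\<in>{U\<in>Pow S. U \<subseteq> T}. weight ^ card T * summand \<sigma> S T U b)"
    using fin by (intro sum.swap_restrict) auto
  also have "\<dots> = glue \<sigma> S b"
    unfolding glue_def sum_distrib_left by (intro sum.cong refl) auto
  finally show ?thesis .
qed

lemma glue_nonneg: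
  assumes "distributions S \<sigma>" "S \<subseteq> I" "I \<noteq> {}" "b \<in> PiE S A"
  shows "0 \<le> glue \<sigma> S b"
proof -
  have "finite S" using assms(2) by (simp add: finite_subset_I)
  then have "0 \<le> weight ^ card S * trunc \<sigma> S b"
    using trunc_nonneg[OF assms(1) _ assms(4)] weight_nonneg by simp
  then show ?thesis using glue_ge[OF assms] by linarith
qed

section \<open>The mass lost by shrinking\<close>

text \<open>The loss at \<open>T\<close> is at most the sum over proper subsets \<open>U\<close> of
  the excess of the marginal of \<open>\<sigma> T\<close> over \<open>trunc \<sigma> U\<close>.
  Compared through \<open>p\<close>, this excess is at most \<open>d\<close> plus the loss at
  \<open>U\<close>, which is the bounded quantity again; the recursion closes by
  \<open>(z + 1) ^ n - z ^ n \<le> z ^ n\<close> with \<open>z = 2 * card I\<close>.\<close>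

lemma trunc_loss:
  assumes "distributions S \<sigma>" "S \<subseteq> I"
    and p: "\<And>T a. T \<subseteq> S \<Longrightarrow> a \<in> PiE T A \<Longrightarrow> marg S T p a \<le> \<sigma> T a"
    and d: "d = 1 - sum p (PiE S A)"
    and "T \<subseteq> S"
  shows "d + (\<Sum>a\<in>PiE T A. \<sigma> T a - trunc \<sigma> T a) \<le> d * (2 * real (card I)) ^ card T"
  using finite_subset_I[OF order_trans[OF assms(5,2)]] assms(5)
proof (induction T rule: finite_psubset_induct)
  case (psubset T)
  note dist = distributions_subset[OF assms(1)]
  have TI: "T \<subseteq> I" using psubset.prems assms(2) by simp
  let ?z = "2 * real (card I)"
  have "sum p (PiE S A) \<le> sum (\<sigma> S) (PiE S A)"
    using p[of S] by (intro sum_mono) (simp add: marg_self)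
  then have d0: "0 \<le> d" using d distributionsD(2)[OF assms(1)] by simp
  show ?case
  proof (cases "T = {}")
    case True
    then show ?thesis
      using trunc_empty[OF dist[OF empty_subsetI]] distributionsD(2)[OF assms(1), of "{}"] by simp
  next
    case False
    let ?m = "\<lambda>U. marg T U (\<sigma> T)"
    \<comment> \<open>\<open>?r U\<close> is the fraction removed by the constraint for
      \<open>U\<close> alone, and \<open>?E U\<close> bounds the mass it removes. Where
      \<open>?m U\<close> vanishes, \<open>?r U\<close> is 1 but there is no mass to remove.\<close>
    let ?r = "\<lambda>U c. max 0 (1 - trunc \<sigma> U c / ?m U c)"
    let ?E = "\<lambda>U. \<Sum>c\<in>PiE U A. max 0 (?m U c - trunc \<sigma> U c)"
    have s0: "0 \<le> \<sigma> T a" if "a \<in> PiE T A" for a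
      using distributionsD(1)[OF assms(1) psubset.prems that] .
    have le: "\<sigma> T a - trunc \<sigma> T a \<le> (\<Sum>U\<in>{U. U \<subset> T}. \<sigma> T a * ?r U (restrict a U))"
      if a: "a \<in> PiE T A" for a
    proof -
      have nn: "0 \<le> \<sigma> T a * ?r U (restrict a U)" for U
        using s0[OF a] by (intro mult_nonneg_nonneg) auto
      \<comment> \<open>The minimum is attained, so a single constraint accounts for the whole loss
        at \<open>a\<close>; the sum over all \<open>U\<close> only overestimates it.\<close>
      have "factor \<sigma> T a \<in> insert 1 ((\<lambda>U. trunc \<sigma> U (restrict a U) / ?m U (restrict a U))
          ` {U. U \<subset> T})"
        unfolding factor_def by (rule Min_in) (auto simp: finite_psubsets psubset.hyps)
      then consider "factor \<sigma> T a = 1"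
        | U where "U \<subset> T" "factor \<sigma> T a = trunc \<sigma> U (restrict a U) / ?m U (restrict a U)"
        by blast
      then show ?thesis
      proof cases
        case 1
        then have "\<sigma> T a - trunc \<sigma> T a = 0"
          using trunc_eq[OF psubset.hyps, of \<sigma> a] by simp
        then show ?thesis using sum_nonneg[of "{U. U \<subset> T}", OF nn] by simp
      next
        case 2
        have "\<sigma> T a - trunc \<sigma> T a = \<sigma> T a * (1 - factor \<sigma> T a)"
          using trunc_eq[OF psubset.hyps, of \<sigma> a] by (simp add: right_diff_distrib)
        also have "\<dots> \<le> \<sigma> T a * ?r U (restrict a U)"
          unfolding 2(2) by (intro mult_left_mono s0[OF a]) simp
        also have "\<dots> \<le> (\<Sum>U\<in>{U. U \<subset> T}. \<sigma> T a * ?r U (restrict a U))"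
          using 2(1) finite_psubsets[OF psubset.hyps] nn by (intro member_le_sum) auto
        finally show ?thesis .
      qed
    qed
    have fibre: "(\<Sum>a\<in>PiE T A. \<sigma> T a * ?r U (restrict a U)) \<le> ?E U" if U: "U \<subset> T" for U
    proof -
      have "(\<Sum>a\<in>PiE T A. \<sigma> T a * ?r U (restrict a U)) =
          (\<Sum>c\<in>PiE U A. marg T U (\<lambda>a. \<sigma> T a * ?r U (restrict a U)) c)"
        using U TI by (intro sum_marg[symmetric]) auto
      also have "\<dots> = (\<Sum>c\<in>PiE U A. ?m U c * ?r U c)"
        by (intro sum.cong refl) (simp add: marg_def sum_distrib_right)
      also have "\<dots> \<le> ?E U"
      proof (rule sum_mono)
        fix c assume "c \<in> PiE U A"
        have "0 \<le> ?m U c" by (intro marg_nonneg s0)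
        then show "?m U c * ?r U c \<le> max 0 (?m U c - trunc \<sigma> U c)"
          by (cases "?m U c = 0") (auto simp: max_def field_simps)
      qed
      finally show ?thesis .
    qed
    have E: "?E U \<le> d * ?z ^ card U" if U: "U \<subset> T" for U
    proof -
      have US: "U \<subseteq> S" "U \<subseteq> T" "U \<subseteq> I" using U psubset.prems assms(2) by auto
      \<comment> \<open>The marginal of \<open>p\<close> lies below both \<open>?m U\<close> and
        \<open>\<sigma> U\<close>, and \<open>trunc \<sigma> U\<close> below
        \<open>\<sigma> U\<close>, so the right side dominates both arguments of \<open>max\<close>.
        The first bracket sums to \<open>d\<close>.\<close>
      have "?E U \<le> (\<Sum>c\<in>PiE U A. (?m U c - marg S U p c) + (\<sigma> U c - trunc \<sigma> U c))"
      proof (rule sum_mono)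
        fix c assume c: "c \<in> PiE U A"
        have "marg S U p c = marg T U (marg S T p) c"
          using U psubset.prems assms(2) by (intro marg_marg[symmetric]) auto
        also have "\<dots> \<le> ?m U c"
          using psubset.prems by (intro marg_mono p) auto
        finally have "marg S U p c \<le> ?m U c" .
        moreover have "trunc \<sigma> U c \<le> \<sigma> U c"
          using US c by (intro trunc_le dist finite_subset_I) auto
        moreover have "marg S U p c \<le> \<sigma> U c" using p US c by auto
        ultimately show "max 0 (?m U c - trunc \<sigma> U c) \<le>
            (?m U c - marg S U p c) + (\<sigma> U c - trunc \<sigma> U c)" by auto
      qed
      also have "\<dots> = d + (\<Sum>c\<in>PiE U A. \<sigma> U c - trunc \<sigma> U c)"
        using sum_marg[of U T "\<sigma> T"] sum_marg[of U S p] US TI assms(2)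
          distributionsD(2)[OF assms(1) psubset.prems]
        by (simp add: sum.distrib sum_subtractf d)
      also have "\<dots> \<le> d * ?z ^ card U" using psubset.IH[OF U] US by simp
      finally show ?thesis .
    qed
    \<comment> \<open>\<open>U = \<emptyset>\<close> costs nothing; this makes room for the initial \<open>d\<close>, so that the binomial sum closes\<close>
    have E0: "?E {} = 0"
    proof -
      have "?m {} (\<lambda>_. undefined) = sum (?m {}) (PiE {} A)" by simp
      also have "\<dots> = 1"
        using sum_marg[of "{}" T "\<sigma> T"] TI distributionsD(2)[OF assms(1) psubset.prems] by simp
      finally show ?thesis using trunc_empty[OF dist[OF empty_subsetI]] by simp
    qed
    have "(\<Sum>a\<in>PiE T A. \<sigma> T a - trunc \<sigma> T a) \<le>
        (\<Sum>a\<in>PiE T A. \<Sum>U\<in>{U. U \<subset> T}. \<sigma> T a * ?r U (restrict a U))"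
      by (intro sum_mono le)
    also have "\<dots> = (\<Sum>U\<in>{U. U \<subset> T}. \<Sum>a\<in>PiE T A. \<sigma> T a * ?r U (restrict a U))"
      by (rule sum.swap)
    also have "\<dots> \<le> (\<Sum>U\<in>{U. U \<subset> T}. ?E U)"
      by (intro sum_mono fibre) auto
    also have "{U. U \<subset> T} = insert {} (Pow T - {T} - {{}})" using False by auto
    also have "(\<Sum>U\<in>insert {} (Pow T - {T} - {{}}). ?E U) = (\<Sum>U\<in>Pow T - {T} - {{}}. ?E U)"
      using psubset.hyps E0 by (subst sum.insert) auto
    also have "\<dots> \<le> (\<Sum>U\<in>Pow T - {T} - {{}}. d * ?z ^ card U)"
      by (intro sum_mono E) auto
    also have "\<dots> = d * ((?z + 1) ^ card T - ?z ^ card T - 1)"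
      unfolding sum_distrib_left[symmetric] sum_power_card_Pow[OF psubset.hyps, symmetric]
      using psubset.hyps False by (simp add: sum_diff1)
    finally have "d + (\<Sum>a\<in>PiE T A. \<sigma> T a - trunc \<sigma> T a) \<le>
        d * ((?z + 1) ^ card T - ?z ^ card T)" by (simp add: algebra_simps)
    also have "\<dots> \<le> d * ?z ^ card T"
    proof (rule mult_left_mono[OF _ d0])
      have "(?z + 1) ^ card T \<le> 2 * ?z ^ card T"
        using card_mono[OF finite_I TI] by (intro power_succ_le_double) simp
      then show "(?z + 1) ^ card T - ?z ^ card T \<le> ?z ^ card T" by linarith
    qed
    finally show ?thesis .
  qed
qed

text \<open>Both \<open>p\<close> and \<open>trunc \<sigma> I\<close> lie below
  \<open>\<sigma> I\<close>, so on any event \<open>V\<close> the truncation falls short of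
  \<open>p\<close> by at most the total loss; \<open>glue_ge\<close> then passes to
  \<open>glue\<close>.\<close>

lemma glue_dominates:
  assumes "distributions I \<sigma>" "I \<noteq> {}"
    and p: "\<And>T a. T \<subseteq> I \<Longrightarrow> a \<in> PiE T A \<Longrightarrow> marg I T p a \<le> \<sigma> T a"
  shows "weight ^ card I * ((\<Sum>a\<in>PiE I A. p a * of_bool (V a)) -
      (2 * real (card I)) ^ card I * (1 - sum p (PiE I A))) \<le>
    (\<Sum>a\<in>PiE I A. glue \<sigma> I a * of_bool (V a))"
proof -
  let ?d = "1 - sum p (PiE I A)"
  have "sum p (PiE I A) \<le> sum (\<sigma> I) (PiE I A)"
    using p[of I] by (intro sum_mono) (simp add: marg_self)
  then have d0: "0 \<le> ?d" using distributionsD(2)[OF assms(1)] by simp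
  have "(\<Sum>a\<in>PiE I A. p a * of_bool (V a)) - (\<Sum>a\<in>PiE I A. trunc \<sigma> I a * of_bool (V a)) =
      (\<Sum>a\<in>PiE I A. (p a - trunc \<sigma> I a) * of_bool (V a))"
    by (simp add: sum_subtractf left_diff_distrib)
  also have "\<dots> \<le> (\<Sum>a\<in>PiE I A. \<sigma> I a - trunc \<sigma> I a)"
  proof (rule sum_mono)
    fix a assume a: "a \<in> PiE I A"
    then show "(p a - trunc \<sigma> I a) * of_bool (V a) \<le> \<sigma> I a - trunc \<sigma> I a"
      using p[of I a] trunc_le[OF assms(1) finite_I a] by (auto simp: marg_self of_bool_def)
  qed
  also have "\<dots> \<le> (2 * real (card I)) ^ card I * ?d"
    using trunc_loss[OF assms(1) order_refl p refl order_refl] d0 by (simp add: mult.commute)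
  finally have "weight ^ card I * ((\<Sum>a\<in>PiE I A. p a * of_bool (V a)) -
      (2 * real (card I)) ^ card I * ?d) \<le>
    weight ^ card I * (\<Sum>a\<in>PiE I A. trunc \<sigma> I a * of_bool (V a))"
    using weight_nonneg by (intro mult_left_mono) auto
  also have "\<dots> \<le> (\<Sum>a\<in>PiE I A. glue \<sigma> I a * of_bool (V a))"
    unfolding sum_distrib_left mult.assoc[symmetric]
    using glue_ge[OF assms(1) order_refl assms(2)] by (intro sum_mono mult_right_mono) auto
  finally show ?thesis .
qed

end

section \<open>From a sub-non-signaling to a non-signaling strategy\<close>

lemma exists_pmf_with_values:
  fixes f :: "'b \<Rightarrow> real"
  assumes "finite B" "\<And>x. x \<in> B \<Longrightarrow> 0 \<le> f x" "sum f B = 1"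
  shows "\<exists>D. set_pmf D \<subseteq> B \<and> (\<forall>x\<in>B. pmf D x = f x)"
proof -
  let ?g = "\<lambda>x. if x \<in> B then f x else 0"
  have "(\<integral>\<^sup>+ x. ennreal (?g x) \<partial>count_space UNIV) = (\<Sum>x\<in>B. ennreal (?g x))"
    using assms(1) by (intro nn_integral_count_space') auto
  also have "\<dots> = ennreal (\<Sum>x\<in>B. ?g x)"
    using assms(2) by (intro sum_ennreal) auto
  also have "(\<Sum>x\<in>B. ?g x) = 1"
    using assms(3) by simp
  finally have D: "pmf (embed_pmf ?g) x = ?g x" for x
    using assms(2) by (intro pmf_embed_pmf) auto
  then have "set_pmf (embed_pmf ?g) \<subseteq> B"
    by (auto simp: set_pmf_iff split: if_splits)
  then show ?thesis using D by (intro exI[of _ "embed_pmf ?g"]) auto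
qed

text \<open>For each \<open>q\<close> the construction is run on the simulators at the restrictions
  of \<open>q\<close>. Its \<open>glue\<close> on \<open>S\<close> is the new simulator for
  \<open>S\<close>, and on all players it is the strategy. \<open>glue_dominates\<close> is then
  averaged over the queries.\<close>

lemma NS_from_subNS:
  fixes G :: "('q, 'a) game"
  assumes G: "is_game G" and k: "num_players G = k" "k \<ge> 1" and p: "p \<in> subNS G"
  shows "\<exists>p'\<in>NS G. (1 / (2 * real k)) ^ k * (win_prob G p - (2 * real k) ^ k * (1 - win_prob G p))
    \<le> win_prob G p'"
proof -
  interpret finite_answers "players G" "answers G"
    using G by unfold_locales (auto simp: is_game_def players_def)
  have card: "card (players G) = k" and ne: "players G \<noteq> {}"
    using k by (auto simp: players_def)
  have marginal: "marginal G r q S b = marg (players G) S (\<lambda>a. pmf (r q) (Some a)) b" for r q S b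
    by (simp add: marginal_def marg_def answers_on_def)
  obtain Sim where sim: "is_simulator G Sim"
    and le: "\<And>q S b. q \<in> all_questions G \<Longrightarrow> S \<subseteq> players G \<Longrightarrow> b \<in> answers_on G S \<Longrightarrow>
      marginal G p q S b \<le> pmf (Sim S (restrict q S)) b"
    using p by (auto simp: subNS_def)
  define \<sigma> where "\<sigma> q T = pmf (Sim T (restrict q T))" for q T
  have dist: "distributions S (\<sigma> q)" if "S \<subseteq> players G" "q \<in> questions_on G S" for S q
    unfolding distributions_def
  proof (intro allI impI conjI ballI)
    fix T assume T: "T \<subseteq> S"
    have "restrict q T \<in> questions_on G T"
      using T that by (auto simp: questions_on_def)
    then have "set_pmf (Sim T (restrict q T)) \<subseteq> answers_on G T"
      using sim T that by (auto simp: is_simulator_def)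
    then show "sum (\<sigma> q T) (PiE T (answers G)) = 1"
      using finite_PiE_A[of T] T that
      by (auto simp: \<sigma>_def answers_on_def intro!: sum_pmf_eq_1)
  qed (simp add: \<sigma>_def)
  have "\<exists>D. set_pmf D \<subseteq> answers_on G S \<and> (\<forall>b\<in>answers_on G S. pmf D b = glue (\<sigma> q) S b)"
    if "S \<subseteq> players G" "q \<in> questions_on G S" for S q
    unfolding answers_on_def using that dist[OF that] ne
    by (intro exists_pmf_with_values finite_PiE_A glue_nonneg sum_glue) auto
  then obtain D where D: "\<And>S q. S \<subseteq> players G \<Longrightarrow> q \<in> questions_on G S \<Longrightarrow>
      set_pmf (D S q) \<subseteq> answers_on G S \<and> (\<forall>b\<in>answers_on G S. pmf (D S q) b = glue (\<sigma> q) S b)"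
    by metis
  define p' :: "('q, 'a) strategy" where "p' q = map_pmf Some (D (players G) q)" for q
  have p': "pmf (p' q) (Some a) = glue (\<sigma> q) (players G) a"
    if "q \<in> all_questions G" "a \<in> all_answers G" for q a
    using D[of "players G" q] that by (simp add: p'_def pmf_map_inj')
  have "p' \<in> NS G"
    unfolding NS_def
  proof (intro CollectI conjI exI[of _ D] ballI allI impI)
    show "is_strategy G p'"
      using D[of "players G"] by (auto simp: is_strategy_def p'_def)
    show "is_simulator G D"
      using D by (auto simp: is_simulator_def)
    fix q S b assume q: "q \<in> all_questions G" and S: "S \<subseteq> players G" and b: "b \<in> answers_on G S"
    have "marginal G p' q S b = marg (players G) S (glue (\<sigma> q) (players G)) b"
      unfolding marginal marg_def using p'[OF q] by (intro sum.cong) (auto simp: answers_on_def)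
    also have "\<dots> = glue (\<sigma> q) S b"
      using q S b dist[of "players G" q] by (intro marg_glue) (auto simp: answers_on_def)
    \<comment> \<open>The non-signaling step: only sets \<open>T \<subseteq> S\<close> enter, and
      \<open>q\<close> and \<open>restrict q S\<close> agree on them.\<close>
    also have "\<dots> = glue (\<sigma> (restrict q S)) S b"
    proof (rule glue_cong)
      show "\<sigma> q T = \<sigma> (restrict q S) T" if "T \<subseteq> S" for T
        using that by (simp add: \<sigma>_def Int_absorb1)
      show "finite S" using S by (rule finite_subset_I)
    qed
    also have "\<dots> = pmf (D S (restrict q S)) b"
    proof -
      have "restrict q S \<in> questions_on G S"
        using q S by (auto simp: questions_on_def)
      then show ?thesis using D[OF S] b by simp
    qed
    finally show "marginal G p' q S b = pmf (D S (restrict q S)) b" .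
  qed
  moreover have "(1 / (2 * real k)) ^ k * (win_prob G p - (2 * real k) ^ k * (1 - win_prob G p))
    \<le> win_prob G p'"
  proof -
    let ?w = "(1 / (2 * real k)) ^ k" and ?X = "(2 * real k) ^ k"
    let ?v = "\<lambda>r q. \<Sum>a\<in>all_answers G. pmf (r q) (Some a) * of_bool (verdict G q a)"
    let ?s = "\<lambda>q. \<Sum>a\<in>all_answers G. pmf (p q) (Some a)"
    let ?\<pi> = "pmf (query_dist G)"
    have one: "(\<Sum>q\<in>all_questions G. ?\<pi> q) = 1"
      using G finite_all_questions[OF G] by (intro sum_pmf_eq_1) (auto simp: is_game_def)
    \<comment> \<open>Aborting never wins, so the average aborting mass is at most
      \<open>1 - win_prob G p\<close>.\<close>
    have "win_prob G p \<le> (\<Sum>q\<in>all_questions G. ?\<pi> q * ?s q)"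
      unfolding win_prob_def by (intro sum_mono mult_left_mono) (auto simp: of_bool_def)
    also have "\<dots> = 1 - (\<Sum>q\<in>all_questions G. ?\<pi> q * (1 - ?s q))"
      using one by (simp add: right_diff_distrib sum_subtractf)
    finally have "?w * (win_prob G p - ?X * (1 - win_prob G p)) \<le>
        ?w * (win_prob G p - ?X * (\<Sum>q\<in>all_questions G. ?\<pi> q * (1 - ?s q)))"
      by (intro mult_left_mono diff_left_mono) auto
    also have "\<dots> = (\<Sum>q\<in>all_questions G. ?\<pi> q * (?w * (?v p q - ?X * (1 - ?s q))))"
      unfolding win_prob_def
      by (simp add: sum_distrib_left sum_subtractf[symmetric] algebra_simps)
    also have "\<dots> \<le> (\<Sum>q\<in>all_questions G. ?\<pi> q * ?v p' q)"
    proof (intro sum_mono mult_left_mono)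
      fix q assume q: "q \<in> all_questions G"
      have "?w * (?v p q - ?X * (1 - ?s q)) \<le>
          (\<Sum>a\<in>all_answers G. glue (\<sigma> q) (players G) a * of_bool (verdict G q a))"
        using glue_dominates[OF dist[OF order_refl q] ne, of "\<lambda>a. pmf (p q) (Some a)"
            "verdict G q"] le[OF q]
        by (simp add: weight_def card marginal \<sigma>_def answers_on_def)
      also have "\<dots> = ?v p' q"
        using p'[OF q] by simp
      finally show "?w * (?v p q - ?X * (1 - ?s q)) \<le> ?v p' q" .
    qed simp
    finally show ?thesis by (simp add: win_prob_def)
  qed
  ultimately show ?thesis by blast
qed

section \<open>From strategies to values, and the constants\<close>

text \<open>\<open>Z\<close> is left open to serve both claims. With
  \<open>X = (2 * real k) ^ k \<le> Z / 2\<close>, losing at most \<open>1 / Z ^ 2\<close> leaves at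
  least 1/2 after subtracting \<open>X\<close> times the loss, and dividing by \<open>X\<close>
  gives \<open>1 / (2 * X)\<close>.\<close>

lemma value_NS_ge:
  assumes G: "is_game G" and k: "num_players G = k" "k \<ge> 1"
    and C: "C \<subseteq> subNS G" "C \<noteq> {}"
    and Z: "2 * (2 * real k) ^ k \<le> Z"
    and v: "game_value G C \<ge> 1 - 1 / Z ^ 2"
  shows "value_NS G \<ge> 1 / Z"
proof -
  let ?X = "(2 * real k) ^ k" and ?v = "game_value G C" and ?n = "value_NS G"
  have X: "?X \<ge> 2"
    using k self_le_power[of "2 * real k" k] by simp
  \<comment> \<open>The bound is solved for \<open>win_prob G p\<close>, so that it passes to the
    supremum without a maximizer.\<close>
  have "win_prob G p \<le> (?n * ?X + ?X) / (1 + ?X)" if p: "p \<in> C" for p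
  proof -
    obtain p' where p': "p' \<in> NS G"
      and *: "(1 / (2 * real k)) ^ k * (win_prob G p - ?X * (1 - win_prob G p)) \<le> win_prob G p'"
      using NS_from_subNS[OF G k, of p] p C by auto
    have "win_prob G p' \<le> ?n"
      unfolding value_NS_def game_value_def by (rule cSUP_upper[OF p' bdd_above_win_prob[OF G]])
    with * have "1 / ?X * (win_prob G p - ?X * (1 - win_prob G p)) \<le> ?n"
      by (simp add: power_divide)
    then show ?thesis using X by (simp add: field_simps)
  qed
  then have "?v \<le> (?n * ?X + ?X) / (1 + ?X)"
    unfolding game_value_def using C(2) by (intro cSUP_least) auto
  then have n: "?v - ?X * (1 - ?v) \<le> ?n * ?X"
    using X by (simp add: field_simps)
  have Z4: "Z \<ge> 4" using X Z by simp
  have "1 / 2 \<le> 1 - 1 / Z ^ 2 - ?X * (1 / Z ^ 2)"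
  proof -
    have "?X * (1 / Z ^ 2) \<le> (Z / 2) * (1 / Z ^ 2)"
      using Z by (intro mult_right_mono) auto
    also have "\<dots> = 1 / (2 * Z)" using Z4 by (simp add: power2_eq_square)
    also have "\<dots> \<le> 1 / 8" using Z4 by (intro divide_left_mono) auto
    finally have "?X * (1 / Z ^ 2) \<le> 1 / 8" .
    moreover have "1 / Z ^ 2 \<le> 1 / 4 ^ 2"
      using Z4 by (intro divide_left_mono power_mono) auto
    ultimately show ?thesis by simp
  qed
  also have "\<dots> \<le> ?v - ?X * (1 - ?v)"
    using v X by (intro diff_mono mult_left_mono) auto
  also note n
  finally have "1 / (2 * ?X) \<le> ?n" using X by (simp add: field_simps)
  moreover have "1 / Z \<le> 1 / (2 * ?X)"
    using Z X by (intro divide_left_mono) auto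
  ultimately show ?thesis by linarith
qed

text \<open>The ranges exclude degenerate cases. At \<open>k = 0\<close> in the first claim, and at
  \<open>k = 1\<close>, \<open>\<delta> = 1\<close> in the second, the premise is value at least 0
  while the conclusion would demand value 1. For \<open>\<delta> < 0\<close> the class of strategies
  is empty.\<close>

theorem theorem4p2:
  "\<exists>c d :: real. c > 0 \<and> d > 0 \<and>
     (\<forall>(k :: nat) (G :: (nat, nat) game). k \<ge> 1 \<and> is_game G \<and> num_players G = k \<longrightarrow>
        (value_subNS G \<ge> 1 - 2 powr (- c * real k ^ 2) \<longrightarrow>
           value_NS G \<ge> 2 powr (- d * real k ^ 2)) \<and>
        (k \<ge> 2 \<longrightarrow>
           (\<forall>\<delta> :: real. 0 \<le> \<delta> \<and> \<delta> \<le> 1 / real k ^ (3 * k) \<longrightarrow>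
              value_subNS_delta \<delta> G \<ge> 1 - \<delta> ^ 2 \<longrightarrow>
              value_NS G \<ge> 1 / real k ^ (3 * k))))"
proof (rule exI[of _ 4], rule exI[of _ 2], intro conjI allI impI)
  \<comment> \<open>Here \<open>Z = 2 ^ (2 * k\<^sup>2)\<close>: the witness 2 is the exponent in
    \<open>1 / Z\<close>, and 4 that in \<open>1 / Z ^ 2\<close>.\<close>
  fix k and G :: "(nat, nat) game"
  assume kG: "k \<ge> 1 \<and> is_game G \<and> num_players G = k"
    and v: "value_subNS G \<ge> 1 - 2 powr (- 4 * real k ^ 2)"
  have powr: "2 powr (- real j * real k ^ 2) = 1 / (2 :: real) ^ (j * k\<^sup>2)" for j
  proof -
    have "2 powr (- real j * real k ^ 2) = 2 powr (- real (j * k\<^sup>2))" by simp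
    also have "\<dots> = 1 / 2 ^ (j * k\<^sup>2)"
      by (simp only: powr_minus_divide powr_realpow[of 2, simplified])
    finally show ?thesis .
  qed
  \<comment> \<open>From \<open>2 * k \<le> 2 ^ k\<close> the power is at most
    \<open>2 ^ k\<^sup>2\<close>; the extra factor 2 fits since
    \<open>1 \<le> k\<^sup>2\<close>.\<close>
  obtain m where m: "k = Suc m" using kG by (cases k) auto
  have "Suc m \<le> 2 ^ m" by (rule Suc_leI) (rule less_exp)
  then have "2 * k \<le> 2 ^ k" by (simp add: m)
  then have "real (2 * k) \<le> real (2 ^ k)" by (rule of_nat_mono)
  then have "2 * (2 * real k) ^ k \<le> 2 * (2 ^ k) ^ k"
    by (intro mult_left_mono power_mono) auto
  also have "\<dots> = 2 ^ (1 + k\<^sup>2)"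
    by (simp add: power_mult[symmetric] power2_eq_square)
  also have "\<dots> \<le> 2 ^ (2 * k\<^sup>2)"
    using kG by (intro power_increasing) auto
  finally have Z: "2 * (2 * real k) ^ k \<le> 2 ^ (2 * k\<^sup>2)" .
  have "value_subNS G \<ge> 1 - 1 / (2 ^ (2 * k\<^sup>2)) ^ 2"
    using v powr[of 4] by (simp add: power_mult[symmetric] mult.commute)
  then have "value_NS G \<ge> 1 / 2 ^ (2 * k\<^sup>2)"
    using kG Z NS_nonempty[of G] NS_subset_subNS[of G]
    by (intro value_NS_ge[of G k "subNS G"]) (auto simp: value_subNS_def)
  then show "value_NS G \<ge> 2 powr (- 2 * real k ^ 2)"
    using powr[of 2] by simp
next
  fix k and G :: "(nat, nat) game" and \<delta> :: real
  assume kG: "k \<ge> 1 \<and> is_game G \<and> num_players G = k" and k: "k \<ge> 2"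
    and \<delta>: "0 \<le> \<delta> \<and> \<delta> \<le> 1 / real k ^ (3 * k)"
    and v: "value_subNS_delta \<delta> G \<ge> 1 - \<delta> ^ 2"
  \<comment> \<open>Now \<open>Z = real k ^ (3 * k)\<close>. Raising the factor 2 to the power
    \<open>k\<close> reduces the bound to \<open>4 * k \<le> k ^ 3\<close>, which is
    \<open>k \<ge> 2\<close>.\<close>
  have "2 * (2 * real k) ^ k \<le> 2 ^ k * (2 * real k) ^ k"
    using k self_le_power[of "2 :: real" k] by (intro mult_right_mono) auto
  also have "\<dots> = (2 * (2 * real k)) ^ k"
    by (rule power_mult_distrib[symmetric])
  also have "\<dots> \<le> (real k ^ 3) ^ k"
  proof (rule power_mono)
    have "2 * 2 * real k \<le> real k * real k * real k"
      using k by (intro mult_mono) auto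
    then show "2 * (2 * real k) \<le> real k ^ 3" by (simp add: power3_eq_cube)
  qed simp
  finally have Z: "2 * (2 * real k) ^ k \<le> real k ^ (3 * k)"
    by (simp add: power_mult)
  \<comment> \<open>A smaller \<open>\<delta>\<close> only strengthens the premise, so it implies
    the one with \<open>1 / Z ^ 2\<close>.\<close>
  have "\<delta> ^ 2 \<le> 1 / (real k ^ (3 * k)) ^ 2"
    using \<delta> power_mono[of \<delta> "1 / real k ^ (3 * k)" 2] by (simp add: power_divide)
  then show "value_NS G \<ge> 1 / real k ^ (3 * k)"
    using kG Z v \<delta> NS_nonempty[of G] NS_subset_subNS_delta[of G \<delta>] subNS_delta_subset[of \<delta> G]
    by (intro value_NS_ge[of G k "subNS_delta \<delta> G"]) (auto simp: value_subNS_delta_def)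
qed auto

end
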